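(* Let $H$ be an infinite-dimensional separable Hilbert space. Let $S\subset\{0,1,2,\dots\}\cup\{\infty\}$ be a set with $0\in S$ such that either $S$ is a finite set of non-negative integers, or $\infty\in S$ (in which case $S$ may be finite or infinite). Then there exists a complete minimal system $\{x_k\}_{k=1}^\infty$ in $H$ such that the set of its defects with respect to all possible subsets of $\mathbb{N}$ is exactly $S$; that is, $\{\operatorname{def}(\sigma):\sigma\subset\mathbb{N}\}=S$, where $\operatorname{def}(\sigma)$ denotes the defect of $\{x_k\}_{k=1}^\infty$ with respect to $\sigma$.
   Context: A system $\{x_k\}_{k=1}^\infty$ in $H$ is complete if its closed linear span is $H$; it is minimal if for every $k$ the vector $x_k$ does not lie in the closed linear span of $\{x_j\}_{j\ne k}$. Minimality is equivalent to the existence of a biorthogonal system $\{x_k^*\}_{k=1}^\infty\subset H$, i.e. $(x_k,x_j^* )=\delta_{k,j}$; if the system is complete, the biorthogonal system is unique. For $\sigma\subset\mathbb{N}$, the defect of the system $\{x_k\}_{k=1}^\infty$ with respect to $\sigma$ is the dimension (an element of $\{0,1,2,\dots\}\cup\{\infty\}$) of the orthogonal complement in $H$ of the closed linear span of $\{x_k\}_{k\in\sigma}\cup\{x_k^*\}_{k\in\mathbb{N}\setminus\sigma}$. *)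

theory Defs
  imports "HOL-Analysis.Analysis" "HOL-Library.Extended_Nat"
begin

text \<open>
  Scalars: both real and complex Hilbert spaces are covered, through a class whose
  instances are \<open>real\<close> and \<open>complex\<close> (by Gelfand-Mazur there are no others up to
  isometric isomorphism, and the last axiom then determines the conjugation).
\<close>

class real_or_complex = real_normed_field +
  fixes conjugate :: "'a \<Rightarrow> 'a"
  assumes conjugate_add: "conjugate (a + b) = conjugate a + conjugate b"
    and conjugate_mult: "conjugate (a * b) = conjugate a * conjugate b"
    and mult_conjugate: "a * conjugate a = ((norm a)\<^sup>2) *\<^sub>R 1"

instantiation real :: real_or_complex
begin
definition conjugate_real :: "real \<Rightarrow> real" where "conjugate_real r = r"
instance
  by standard (auto simp: conjugate_real_def power2_eq_square)
end

instantiation complex :: real_or_complex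
begin
definition conjugate_complex :: "complex \<Rightarrow> complex" where "conjugate_complex = cnj"
instance
proof
  fix a b :: complex
  show "conjugate (a + b) = conjugate a + conjugate b"
    and "conjugate (a * b) = conjugate a * conjugate b"
    by (simp_all add: conjugate_complex_def)
  show "a * conjugate a = ((norm a)\<^sup>2) *\<^sub>R 1"
    unfolding conjugate_complex_def scaleR_conv_of_real
    by (simp only: complex_norm_square mult_1_right)
qed
end

text \<open>
  Completeness and the topology come from the class \<open>banach\<close>; the axiom \<open>ip_self\<close>
  makes its norm the Hilbert space norm (and the inner product positive definite).
  The inner product is linear in its first argument.
\<close>

locale hilbert_space = vector_space scale
  for scale :: "'k::real_or_complex \<Rightarrow> 'a::banach \<Rightarrow> 'a" +
  fixes ip :: "'a \<Rightarrow> 'a \<Rightarrow> 'k"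
  assumes scale_of_real: "scale (of_real r) x = r *\<^sub>R x"
    and ip_add_left: "ip (x + y) z = ip x z + ip y z"
    and ip_scale_left: "ip (scale c x) y = c * ip x y"
    and ip_commute: "ip x y = conjugate (ip y x)"
    and ip_self: "ip x x = of_real ((norm x)\<^sup>2)"
begin

definition closed_span :: "'a set \<Rightarrow> 'a set" where
  "closed_span A = closure (span A)"

definition orth_compl :: "'a set \<Rightarrow> 'a set" where
  "orth_compl A = {z. \<forall>a\<in>A. ip z a = 0}"

text \<open>The library's \<open>dim\<close> is a natural number and carries no information in infinite dimension.\<close>

definition edim :: "'a set \<Rightarrow> enat" where
  "edim V = (if \<exists>B. finite B \<and> V \<subseteq> span B then enat (dim V) else \<infinity>)"

definition complete_system :: "(nat \<Rightarrow> 'a) \<Rightarrow> bool" where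
  "complete_system x \<longleftrightarrow> closed_span (range x) = UNIV"

definition minimal_system :: "(nat \<Rightarrow> 'a) \<Rightarrow> bool" where
  "minimal_system x \<longleftrightarrow> (\<forall>k. x k \<notin> closed_span (x ` {j. j \<noteq> k}))"

definition biorthogonal :: "(nat \<Rightarrow> 'a) \<Rightarrow> (nat \<Rightarrow> 'a) \<Rightarrow> bool" where
  "biorthogonal x x' \<longleftrightarrow> (\<forall>k j. ip (x k) (x' j) = (if k = j then 1 else 0))"

text \<open>
  The second argument is meant to be the system biorthogonal to the first, which is
  uniquely determined when the first is complete and minimal.
\<close>

definition defect :: "(nat \<Rightarrow> 'a) \<Rightarrow> (nat \<Rightarrow> 'a) \<Rightarrow> nat set \<Rightarrow> enat" where
  "defect x x' \<sigma> = edim (orth_compl (closed_span (x ` \<sigma> \<union> x' ` (- \<sigma>))))"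

end

end

theory Submission
  imports Defs
begin

text \<open>
  Split an orthonormal basis into \<open>(\<phi> i)\<close>, \<open>i \<in> I\<close>, and \<open>(e k)\<close>, \<open>k \<in> \<nat>\<close>, and put
  \<open>x k = q k ^ k e k + (\<Sum>i\<ge>b k. q k ^ i \<phi> i)\<close>, where \<open>q k\<close> tends to 0. Since the \<open>e k\<close>-component
  decays faster than every fixed power of \<open>q k\<close>, any infinitely many \<open>x k\<close> with \<open>b k = n\<close> recover
  all \<open>\<phi> i\<close> with \<open>i \<ge> n\<close> in their closed span, one after the other. A finite number of
  indices \<open>k\<close>, on the other hand, can be compensated by a finite combination of the \<open>e k\<close>.
  Hence the defect with respect to \<open>\<sigma>\<close> counts the \<open>i \<in> I\<close> that lie below every \<open>n\<close> for which
  \<open>\<sigma>\<close> contains infinitely many \<open>k\<close> with \<open>b k = n\<close>. It remains to let \<open>b\<close> take each finite value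
  of \<open>S\<close> infinitely often and to choose \<open>I\<close> as the set of integers below the supremum of \<open>S\<close>.
\<close>

section \<open>Conjugation, inner products and their continuity\<close>

lemma conjugate_0 [simp]: "conjugate (0::'k::real_or_complex) = 0"
  using conjugate_add[of "0::'k" 0] by simp

lemma conjugate_of_real [simp]: "conjugate (of_real r :: 'k::real_or_complex) = of_real r"
proof (cases "r = 0")
  case False
  have "of_real r * conjugate (of_real r :: 'k) = of_real r * of_real r"
    using mult_conjugate[of "of_real r :: 'k"]
    by (simp add: scaleR_conv_of_real power2_eq_square flip: of_real_mult)
  then show ?thesis using False by simp
qed simp

context hilbert_space
begin

lemma ip_add_right: "ip x (y + z) = ip x y + ip x z"
  by (metis ip_add_left ip_commute conjugate_add)

lemma ip_scaleR_left [simp]: "ip (r *\<^sub>R x) y = of_real r * ip x y"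
  by (metis ip_scale_left scale_of_real)

lemma ip_scaleR_right [simp]: "ip x (r *\<^sub>R y) = of_real r * ip x y"
  by (metis ip_scaleR_left ip_commute conjugate_mult conjugate_of_real)

lemma ip_scale_right: "ip x (scale c y) = conjugate c * ip x y"
  by (metis ip_scale_left ip_commute conjugate_mult)

lemma ip_zero_left [simp]: "ip 0 y = 0"
  using ip_scaleR_left[of 0 0 y] by simp

lemma ip_minus_left: "ip (- x) y = - ip x y"
  using ip_scaleR_left[of "-1" x y] by simp

lemma ip_diff_left: "ip (x - y) z = ip x z - ip y z"
  using ip_add_left[of x "- y" z] by (simp add: ip_minus_left)

lemma ip_sum_left: "ip (sum f A) y = (\<Sum>a\<in>A. ip (f a) y)"
  by (induction A rule: infinite_finite_induct) (auto simp: ip_add_left)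

lemma ip_eq_0_commute: "ip x y = 0 \<longleftrightarrow> ip y x = 0"
  by (metis ip_commute conjugate_0)

lemma ip_self_eq_0_iff: "ip x x = 0 \<longleftrightarrow> x = 0"
  by (simp add: ip_self)

text \<open>The class \<open>banach\<close> gives homogeneity for real scalars; for general
  \<open>c\<close> it follows from the inner product, with \<open>mult_conjugate\<close> producing
  the square of \<open>norm c\<close>.\<close>

lemma norm_scale: "norm (scale c x) = norm c * norm x"
proof -
  have "of_real ((norm (scale c x))\<^sup>2) = (c * conjugate c) * ip x x"
    by (simp only: ip_self[symmetric] ip_scale_left ip_scale_right mult.assoc mult.left_commute)
  also have "\<dots> = of_real ((norm c * norm x)\<^sup>2)"
    by (simp add: mult_conjugate ip_self scaleR_conv_of_real power_mult_distrib)
  finally have "of_real ((norm (scale c x))\<^sup>2) = (of_real ((norm c * norm x)\<^sup>2) :: 'k)" .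
  then show ?thesis
    unfolding of_real_eq_iff by (simp add: power2_eq_iff_nonneg)
qed

lemma cauchy_schwarz: "norm (ip x y) \<le> norm x * norm y"
proof (cases "y = 0")
  case True
  then show ?thesis using ip_eq_0_commute[of x 0] by simp
next
  case False
  define c where "c = ip x y"
  define N where "N = (norm y)\<^sup>2"
  \<comment> \<open>The component of the first vector orthogonal to \<open>y\<close>, multiplied by
    \<open>N\<close> to avoid dividing. Its square norm, expanded, is the desired
    inequality.\<close>
  define z where "z = N *\<^sub>R x - scale c y"
  have N: "N > 0" using False by (simp add: N_def)
  have zy: "ip z y = 0"
    by (simp add: z_def ip_diff_left ip_scale_left c_def N_def ip_self mult.commute)
  have "ip z z = ip z (N *\<^sub>R x + scale (- c) y)"
    by (simp add: z_def)
  also have "\<dots> = of_real N * ip z x"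
    by (simp add: ip_add_right ip_scale_right zy del: scale_minus_left)
  also have "ip z x = of_real N * of_real ((norm x)\<^sup>2) - c * conjugate c"
    using ip_commute[of y x] by (simp add: z_def ip_diff_left ip_scale_left ip_self c_def)
  also have "\<dots> = of_real (N * (norm x)\<^sup>2 - (norm c)\<^sup>2)"
    by (simp add: mult_conjugate scaleR_conv_of_real)
  finally have "of_real ((norm z)\<^sup>2) = (of_real (N * (N * (norm x)\<^sup>2 - (norm c)\<^sup>2)) :: 'k)"
    by (simp add: ip_self)
  then have "0 \<le> N * (N * (norm x)\<^sup>2 - (norm c)\<^sup>2)"
    unfolding of_real_eq_iff by (metis zero_le_power2)
  then have "(norm c)\<^sup>2 \<le> (norm x * norm y)\<^sup>2"
    using N by (simp add: zero_le_mult_iff N_def power_mult_distrib mult.commute)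
  then show ?thesis
    unfolding c_def by (rule power2_le_imp_le) simp
qed

lemma bounded_linear_ip_left: "bounded_linear (\<lambda>x. ip x y)"
  by (rule bounded_linear_intro[where K = "norm y"])
     (auto simp: ip_add_left scaleR_conv_of_real cauchy_schwarz)

text \<open>Conjugate-linearity is linearity over the reals, which is all that
  \<open>bounded_linear\<close> asks for.\<close>

lemma bounded_linear_ip_right: "bounded_linear (ip x)"
  by (rule bounded_linear_intro[where K = "norm x"])
     (auto simp: ip_add_right scaleR_conv_of_real mult.commute[of _ "norm x"] cauchy_schwarz)

lemma bounded_linear_scale_right: "bounded_linear (scale c)"
  by (rule bounded_linear_intro[where K = "norm c"])
     (auto simp: scale_right_distrib norm_scale mult.commute scale_left_commute
           simp flip: scale_of_real)

lemma bounded_linear_scale_left: "bounded_linear (\<lambda>c. scale c x)"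
  by (rule bounded_linear_intro[where K = "norm x"])
     (auto simp: scale_left_distrib norm_scale scaleR_conv_of_real simp flip: scale_of_real)

section \<open>Closed spans and orthogonality\<close>

lemma subspace_closure: assumes "subspace V" shows "subspace (closure V)"
proof (rule subspaceI)
  show "0 \<in> closure V" using assms subspace_0 closure_subset by blast
next
  fix x y assume "x \<in> closure V" "y \<in> closure V"
  then obtain f g where "\<forall>n. f n \<in> V" "f \<longlonglongrightarrow> x" "\<forall>n. g n \<in> V" "g \<longlonglongrightarrow> y"
    unfolding closure_sequential by blast
  then have "\<forall>n. f n + g n \<in> V" "(\<lambda>n. f n + g n) \<longlonglongrightarrow> x + y"
    using assms by (auto intro: subspace_add tendsto_add)
  then show "x + y \<in> closure V"
    unfolding closure_sequential by (intro exI[of _ "\<lambda>n. f n + g n"] conjI)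
next
  fix c x assume "x \<in> closure V"
  then obtain f where "\<forall>n. f n \<in> V" "f \<longlonglongrightarrow> x"
    unfolding closure_sequential by blast
  then have "\<forall>n. scale c (f n) \<in> V" "(\<lambda>n. scale c (f n)) \<longlonglongrightarrow> scale c x"
    using assms bounded_linear.tendsto[OF bounded_linear_scale_right]
    by (auto intro: subspace_scale)
  then show "scale c x \<in> closure V"
    unfolding closure_sequential by (intro exI[of _ "\<lambda>n. scale c (f n)"] conjI)
qed

lemma subspace_closed_span: "subspace (closed_span A)"
  by (simp add: closed_span_def subspace_closure)

lemma closed_closed_span: "closed (closed_span A)"
  by (simp add: closed_span_def)

lemma closed_span_superset: "A \<subseteq> closed_span A"
  unfolding closed_span_def using span_superset closure_subset by blast

lemma closed_span_mono: "A \<subseteq> B \<Longrightarrow> closed_span A \<subseteq> closed_span B"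
  by (simp add: closed_span_def closure_mono span_mono)

lemma closed_span_minimal: "A \<subseteq> V \<Longrightarrow> subspace V \<Longrightarrow> closed V \<Longrightarrow> closed_span A \<subseteq> V"
  by (simp add: closed_span_def closure_minimal span_minimal)

lemma scaleR_mem_subspace: "subspace V \<Longrightarrow> x \<in> V \<Longrightarrow> r *\<^sub>R x \<in> V"
  by (metis scale_of_real subspace_scale)

lemma closed_span_orth:
  assumes "\<And>a. a \<in> A \<Longrightarrow> ip z a = 0" "y \<in> closed_span A"
  shows "ip z y = 0"
proof -
  have "closed_span A \<subseteq> {y. ip z y = 0}"
  proof (rule closed_span_minimal)
    show "closed {y. ip z y = 0}"
      by (intro closed_Collect_eq bounded_linear.continuous_on[OF bounded_linear_ip_right]
            continuous_on_id continuous_on_const)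
    show "subspace {y. ip z y = 0}"
      using ip_scaleR_right[of z 0 0]
      by (intro subspaceI) (auto simp: ip_add_right ip_scale_right)
  qed (use assms in auto)
  then show ?thesis using assms by auto
qed

lemma closed_span_orth_left:
  assumes "\<And>a. a \<in> A \<Longrightarrow> ip a z = 0" "y \<in> closed_span A"
  shows "ip y z = 0"
  using closed_span_orth[of A z y] assms by (metis ip_eq_0_commute)

lemma orth_compl_closed_span: "orth_compl (closed_span A) = orth_compl A"
  unfolding orth_compl_def using closed_span_orth closed_span_superset by blast

lemma zero_if_orth_dense:
  assumes "closed_span A = UNIV" "\<And>a. a \<in> A \<Longrightarrow> ip z a = 0"
  shows "z = 0"
  using closed_span_orth[of A z z] assms by (simp add: ip_self_eq_0_iff)

lemma subspace_orth_compl: "subspace (orth_compl A)"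
  unfolding orth_compl_def by (rule subspaceI) (auto simp: ip_add_left ip_scale_left)

text \<open>The vector \<open>x' k\<close> annihilates the closed span of all the other members of
  the system, but not \<open>x k\<close>.\<close>

lemma minimal_if_biorthogonal:
  assumes "biorthogonal x x'" shows "minimal_system x"
  unfolding minimal_system_def
proof (intro allI notI)
  fix k assume "x k \<in> closed_span (x ` {j. j \<noteq> k})"
  then have "ip (x k) (x' k) = 0"
    by (rule closed_span_orth_left[rotated]) (use assms in \<open>auto simp: biorthogonal_def\<close>)
  then show False using assms by (simp add: biorthogonal_def)
qed

section \<open>Gram-Schmidt and orthonormal bases\<close>

text \<open>Since \<open>sgn 0 = 0\<close>, a vector linearly dependent on its predecessors produces \<open>0\<close>.\<close>

fun gram_schmidt :: "(nat \<Rightarrow> 'a) \<Rightarrow> nat \<Rightarrow> 'a" where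
  "gram_schmidt d n =
     sgn (d n - (\<Sum>j<n. scale (ip (d n) (gram_schmidt d j)) (gram_schmidt d j)))"

declare gram_schmidt.simps [simp del]

lemma ip_gram_schmidt_self:
  "ip (gram_schmidt d n) (gram_schmidt d n) = (if gram_schmidt d n = 0 then 0 else 1)"
  unfolding gram_schmidt.simps[of d n] by (simp add: ip_self norm_sgn sgn_zero_iff)

lemma gram_schmidt_orth_less: "m < n \<Longrightarrow> ip (gram_schmidt d n) (gram_schmidt d m) = 0"
proof (induction n arbitrary: m rule: less_induct)
  case (less n)
  let ?g = "gram_schmidt d"
  have orth: "ip (?g j) (?g m) = 0" if "j < n" "j \<noteq> m" for j
    using less.IH[of j m] less.IH[of m j] that less.prems ip_eq_0_commute
    by (metis linorder_neqE_nat)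
  \<comment> \<open>By induction the earlier vectors are pairwise orthogonal, so only the term
    \<open>j = m\<close> survives. If \<open>?g m\<close> is 0, both sides of the next equation
    vanish; otherwise \<open>?g m\<close> has norm 1.\<close>
  have "(\<Sum>j<n. ip (d n) (?g j) * ip (?g j) (?g m)) =
      (\<Sum>j<n. if j = m then ip (d n) (?g m) * ip (?g m) (?g m) else 0)"
    by (rule sum.cong) (auto simp: orth)
  also have "\<dots> = ip (d n) (?g m)"
    using less.prems ip_gram_schmidt_self[of d m] ip_eq_0_commute[of "d n" 0] by auto
  finally have "ip (d n - (\<Sum>j<n. scale (ip (d n) (?g j)) (?g j))) (?g m) = 0"
    by (simp add: ip_diff_left ip_sum_left ip_scale_left)
  then show ?case
    unfolding gram_schmidt.simps[of d n] by (simp add: sgn_div_norm)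
qed

lemma gram_schmidt_orth: "m \<noteq> n \<Longrightarrow> ip (gram_schmidt d n) (gram_schmidt d m) = 0"
  by (metis gram_schmidt_orth_less ip_eq_0_commute linorder_neqE_nat)

lemma mem_span_gram_schmidt: "d n \<in> span (range (gram_schmidt d))"
proof -
  let ?s = "\<Sum>j<n. scale (ip (d n) (gram_schmidt d j)) (gram_schmidt d j)"
  have "d n = ?s + norm (d n - ?s) *\<^sub>R gram_schmidt d n"
    unfolding gram_schmidt.simps[of d n] by (cases "d n = ?s") (simp_all add: sgn_div_norm)
  moreover have "?s + norm (d n - ?s) *\<^sub>R gram_schmidt d n \<in> span (range (gram_schmidt d))"
    by (intro span_add span_sum span_scale scaleR_mem_subspace subspace_span)
       (auto intro: span_base)
  ultimately show ?thesis by simp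
qed

text \<open>The orthogonal projection \<open>P\<close> is continuous, so its fixed points form a
  closed subspace containing \<open>G\<close>; every fixed point lies in the range of
  \<open>P\<close> and hence in \<open>span G\<close>.\<close>

lemma closed_span_finite_orthonormal:
  assumes "finite G" "\<And>g h. g \<in> G \<Longrightarrow> h \<in> G \<Longrightarrow> ip g h = (if g = h then 1 else 0)"
  shows "closed_span G = span G"
proof -
  define P where "P x = (\<Sum>g\<in>G. scale (ip x g) g)" for x
  have P: "continuous_on UNIV P"
    unfolding P_def
    by (intro continuous_on_sum bounded_linear.continuous_on[OF bounded_linear_scale_left]
          bounded_linear.continuous_on[OF bounded_linear_ip_left] continuous_on_id)
  have "closed_span G \<subseteq> {x. P x = x}"
  proof (rule closed_span_minimal)
    show "closed {x. P x = x}" by (intro closed_Collect_eq P continuous_on_id)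
    show "subspace {x. P x = x}"
      by (rule subspaceI)
         (simp_all add: P_def ip_add_left ip_scale_left scale_left_distrib sum.distrib
            flip: scale_scale scale_sum_right)
    have "P h = h" if "h \<in> G" for h
    proof -
      have "P h = (\<Sum>g\<in>G. if g = h then h else 0)"
        unfolding P_def by (rule sum.cong) (auto simp: assms(2) that)
      then show ?thesis using assms(1) that by simp
    qed
    then show "G \<subseteq> {x. P x = x}" by auto
  qed
  moreover have "P x \<in> span G" for x
    unfolding P_def by (intro span_sum span_scale span_base)
  ultimately have "closed_span G \<subseteq> span G"
    by (metis (mono_tags, lifting) mem_Collect_eq subset_eq)
  then show ?thesis
    unfolding closed_span_def using closure_subset by blast
qed

text \<open>Orthonormalise a countable dense sequence and drop the zeros. A finite result would have
  a closed span equal to its span, contradicting infinite dimension.\<close>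

lemma orthonormal_basis_exists:
  assumes "separable_space (euclidean :: 'a topology)" "edim (UNIV :: 'a set) = \<infinity>"
  obtains G where "countable G" "infinite G" "closed_span G = UNIV"
    "\<And>g h. g \<in> G \<Longrightarrow> h \<in> G \<Longrightarrow> ip g h = (if g = h then 1 else 0)"
proof -
  obtain C :: "'a set" where C: "countable C" "closure C = UNIV"
    using assms(1) by (auto simp: separable_space_def)
  have "C \<noteq> {}" using C(2) by auto
  then obtain d :: "nat \<Rightarrow> 'a" where d: "range d = C"
    using C(1) by (metis uncountable_def)
  define G where "G = range (gram_schmidt d) - {0}"
  have orth: "ip g h = (if g = h then 1 else 0)" if "g \<in> G" "h \<in> G" for g h
    using that gram_schmidt_orth[of _ _ d] ip_gram_schmidt_self[of d] unfolding G_def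
    by (smt (verit) Diff_iff image_iff singletonI)
  have "range (gram_schmidt d) \<subseteq> span G"
  proof (rule image_subsetI)
    fix n show "gram_schmidt d n \<in> span G"
      by (cases "gram_schmidt d n = 0") (auto simp: G_def span_zero intro: span_base)
  qed
  then have "C \<subseteq> span G"
    using mem_span_gram_schmidt[of d] span_minimal[OF _ subspace_span] unfolding d[symmetric]
    by blast
  then have dense: "closed_span G = UNIV"
    using C(2) closure_mono[of C "span G"] by (auto simp: closed_span_def)
  have "infinite G"
  proof
    assume "finite G"
    then have "UNIV = span G" using closed_span_finite_orthonormal orth dense by metis
    then have "edim (UNIV :: 'a set) \<noteq> \<infinity>" using \<open>finite G\<close> by (auto simp: edim_def)
    then show False using assms(2) by simp
  qed
  then show thesis using that[of G] dense orth by (simp add: G_def)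
qed

section \<open>Dimension through a dual family\<close>

text \<open>Pairing a linear relation among the \<open>w i\<close> with \<open>f j\<close> isolates
  one coefficient, so the \<open>w i\<close> are independent. They form a basis if \<open>J\<close>
  is finite; if \<open>J\<close> is infinite, no finite set can span them.\<close>

lemma edim_eq:
  assumes "subspace V" "\<And>i. i \<in> J \<Longrightarrow> w i \<in> V"
    and "\<And>i j. i \<in> J \<Longrightarrow> j \<in> J \<Longrightarrow> ip (w i) (f j) = (if i = j then 1 else 0)"
    and "finite J \<Longrightarrow> V \<subseteq> span (w ` J)"
  shows "edim V = (if finite J then enat (card J) else \<infinity>)"
proof -
  have inj: "inj_on w J"
    by (rule inj_onI) (metis assms(3) zero_neq_one)
  have indep: "independent (w ` J)"
    unfolding dependent_explicit
  proof safe
    fix t u b assume t: "finite t" "t \<subseteq> w ` J" "(\<Sum>v\<in>t. scale (u v) v) = 0" "b \<in> t" "u b \<noteq> 0"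
    then obtain j where j: "j \<in> J" "b = w j" by auto
    have "0 = ip (\<Sum>v\<in>t. scale (u v) v) (f j)" using t by simp
    also have "\<dots> = (\<Sum>v\<in>t. u v * ip v (f j))" by (simp add: ip_sum_left ip_scale_left)
    also have "\<dots> = (\<Sum>v\<in>t. if v = b then u b else 0)"
    proof (rule sum.cong)
      fix v assume "v \<in> t"
      then obtain i where i: "i \<in> J" "v = w i" using t by auto
      show "u v * ip v (f j) = (if v = b then u b else 0)"
        using i j assms(3)[of i j] inj by (auto simp: inj_on_def)
    qed simp
    also have "\<dots> = u b" using t by simp
    finally show False using t by simp
  qed
  show ?thesis
  proof (cases "finite J")
    case True
    have "span (w ` J) = V"
      using assms(1,2,4) True span_minimal[of "w ` J" V] by auto
    then have "dim V = card J"
      using dim_eq_card[OF _ indep, of V] inj span_eq_iff[THEN iffD2, OF assms(1)] by (simp add: card_image)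
    then show ?thesis
      using True assms(4) unfolding edim_def by (metis finite_imageI)
  next
    case False
    have "\<not> (finite B \<and> V \<subseteq> span B)" for B
      using independent_span_bound[OF _ indep, of B] finite_imageD[OF _ inj] False assms(2) by blast
    then show ?thesis using False by (simp add: edim_def)
  qed
qed

end

section \<open>The perturbed basis and its biorthogonal system\<close>

text \<open>The first assumption gives \<open>\<phi> i = 0\<close> for \<open>i \<notin> I\<close>, so that a series over \<open>I\<close> can be written as one over the naturals.\<close>

locale perturbed_basis = hilbert_space scale ip
  for scale :: "'k::real_or_complex \<Rightarrow> 'a::banach \<Rightarrow> 'a" and ip :: "'a \<Rightarrow> 'a \<Rightarrow> 'k" +
  fixes \<phi> e :: "nat \<Rightarrow> 'a" and I :: "nat set" and b :: "nat \<Rightarrow> nat"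
  assumes ip_\<phi>: "ip (\<phi> i) (\<phi> j) = (if i = j \<and> i \<in> I then 1 else 0)"
    and ip_e: "ip (e k) (e l) = (if k = l then 1 else 0)"
    and ip_\<phi>_e: "ip (\<phi> i) (e k) = 0"
    and dense: "closed_span (range \<phi> \<union> range e) = UNIV"
begin

text \<open>The exponent \<open>Suc k\<close> keeps every value at most 1/2, including at
  \<open>k = 0\<close>, so each geometric series converges with sum at most 2.\<close>

definition q :: "nat \<Rightarrow> real" where "q k = (1 / 2) ^ Suc k"

definition coef :: "nat \<Rightarrow> nat \<Rightarrow> real" where
  "coef k i = (if b k \<le> i then q k ^ i else 0)"

definition x :: "nat \<Rightarrow> 'a" where
  "x k = q k ^ k *\<^sub>R e k + (\<Sum>i. coef k i *\<^sub>R \<phi> i)"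

definition x' :: "nat \<Rightarrow> 'a" where
  "x' k = (1 / q k ^ k) *\<^sub>R e k"

lemma q_pos: "q k > 0" by (simp add: q_def)

lemma q_le_half: "q k \<le> 1 / 2"
  using power_decreasing[of 1 "Suc k" "1/2::real"] by (simp add: q_def)

lemma coef_bounds: "0 \<le> coef k i" "coef k i \<le> q k ^ i"
  using q_pos[of k] by (auto simp: coef_def)

lemma norm_e: "norm (e k) = 1"
proof -
  have "of_real ((norm (e k))\<^sup>2) = (of_real (1\<^sup>2) :: 'k)"
    unfolding ip_self[symmetric] by (simp add: ip_e)
  then show ?thesis
    unfolding of_real_eq_iff by (rule power2_eq_imp_eq) auto
qed

lemma norm_\<phi>: "norm (\<phi> i) \<le> 1"
proof -
  have "of_real ((norm (\<phi> i))\<^sup>2) = (of_real (if i \<in> I then 1 else 0) :: 'k)"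
    unfolding ip_self[symmetric] by (simp add: ip_\<phi>)
  then have "(norm (\<phi> i))\<^sup>2 \<le> 1\<^sup>2" unfolding of_real_eq_iff by auto
  then show ?thesis by (rule power2_le_imp_le) simp
qed

lemma norm_coef_\<phi>: "norm (coef k i *\<^sub>R \<phi> i) \<le> q k ^ i"
  using mult_mono[OF coef_bounds(2)[of k i] norm_\<phi>[of i]] coef_bounds(1)[of k i] q_pos[of k]
  by simp

lemma summable_q: "summable (\<lambda>i. q k ^ i)"
  using q_pos[of k] q_le_half[of k] by (intro summable_geometric) simp

lemma summable_coef_\<phi>: "summable (\<lambda>i. coef k i *\<^sub>R \<phi> i)"
  by (rule summable_comparison_test'[OF summable_q]) (rule norm_coef_\<phi>)

lemma ip_series: "(\<lambda>i. of_real (coef k i) * ip z (\<phi> i)) sums ip z (\<Sum>i. coef k i *\<^sub>R \<phi> i)"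
  using bounded_linear.sums[OF bounded_linear_ip_right summable_sums[OF summable_coef_\<phi>], of z k]
  by simp

lemma ip_\<phi>_series: "ip (\<phi> j) (\<Sum>i. coef k i *\<^sub>R \<phi> i) = (if j \<in> I then of_real (coef k j) else 0)"
proof -
  have "(\<lambda>i. if i = j then (if j \<in> I then of_real (coef k j) else 0) else (0::'k)) =
      (\<lambda>i. of_real (coef k i) * ip (\<phi> j) (\<phi> i))"
    by (auto simp: ip_\<phi>)
  then have "(\<lambda>i. of_real (coef k i) * ip (\<phi> j) (\<phi> i)) sums
      (if j \<in> I then of_real (coef k j) else 0)"
    using sums_single[of j "\<lambda>_. if j \<in> I then of_real (coef k j) else (0::'k)"] by simp
  then show ?thesis
    by (rule sums_unique2[OF ip_series])
qed

lemma series_orth: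
  assumes "\<And>i. ip z (\<phi> i) = 0"
  shows "ip z (\<Sum>i. coef k i *\<^sub>R \<phi> i) = 0"
  using ip_series[of k z] by (simp add: assms sums_iff)

lemma ip_e_\<phi>: "ip (e k) (\<phi> i) = 0"
  using ip_\<phi>_e ip_eq_0_commute by blast

text \<open>The series part of each \<open>x k\<close> is orthogonal to every \<open>e j\<close>, so
  only the \<open>e\<close>-component pairs with \<open>x' j\<close>.\<close>

lemma biorthogonal_x: "biorthogonal x x'"
proof -
  have "ip (\<Sum>i. coef k i *\<^sub>R \<phi> i) (e j) = 0" for k j
    using series_orth[of "e j" k] ip_e_\<phi> ip_eq_0_commute by blast
  then show ?thesis
    using q_pos by (auto simp: biorthogonal_def x_def x'_def ip_add_left ip_e less_imp_neq[symmetric])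
qed

section \<open>Recovering the basis from the system\<close>

text \<open>Past the first \<open>p\<close> terms the leading one is
  \<open>q k ^ p *\<^sub>R \<phi> p\<close>. The later terms contribute at most
  \<open>2 * q k ^ Suc p\<close>, and the \<open>e\<close>-component at most
  \<open>q k ^ Suc p\<close> because \<open>p < k\<close>.\<close>

lemma \<phi>_approx:
  assumes "b k \<le> p" "p < k"
  shows "norm ((1 / q k ^ p) *\<^sub>R (x k - (\<Sum>i<p. coef k i *\<^sub>R \<phi> i)) - \<phi> p) \<le> 3 * q k"
proof -
  define r where "r = (\<Sum>i. coef k (i + Suc p) *\<^sub>R \<phi> (i + Suc p))"
  have "norm r \<le> (\<Sum>i. q k ^ (i + Suc p))"
    unfolding r_def
    by (rule norm_suminf_le[OF norm_coef_\<phi>]) (simp only: summable_iff_shift summable_q)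
  also have "\<dots> = q k ^ Suc p * (1 / (1 - q k))"
    using q_pos[of k] q_le_half[of k] suminf_mult[OF summable_q, where c = "q k ^ Suc p"]
    by (simp add: power_add suminf_geometric mult.commute mult.left_commute)
  also have "\<dots> \<le> q k ^ Suc p * 2"
    using q_pos[of k] q_le_half[of k] by (intro mult_left_mono) (auto simp: field_simps)
  finally have r: "norm r \<le> 2 * q k * q k ^ p" by (simp add: mult_ac)
  have "q k ^ k \<le> q k ^ Suc p"
    using assms q_pos[of k] q_le_half[of k] by (intro power_decreasing) auto
  then have "norm (q k ^ k *\<^sub>R e k + r) \<le> q k * q k ^ p + 2 * q k * q k ^ p"
    using q_pos[of k] r by (intro norm_triangle_mono) (auto simp: norm_e)
  also have "\<dots> = 3 * q k * q k ^ p" by simp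
  finally have bound: "norm (q k ^ k *\<^sub>R e k + r) \<le> 3 * q k * q k ^ p" .
  have "(\<Sum>i. coef k i *\<^sub>R \<phi> i) = r + (\<Sum>i<Suc p. coef k i *\<^sub>R \<phi> i)"
    unfolding r_def by (rule suminf_split_initial_segment[OF summable_coef_\<phi>])
  then have "x k - (\<Sum>i<p. coef k i *\<^sub>R \<phi> i) = (q k ^ k *\<^sub>R e k + r) + q k ^ p *\<^sub>R \<phi> p"
    using assms by (simp add: x_def coef_def)
  then have "(1 / q k ^ p) *\<^sub>R (x k - (\<Sum>i<p. coef k i *\<^sub>R \<phi> i)) - \<phi> p =
      (1 / q k ^ p) *\<^sub>R (q k ^ k *\<^sub>R e k + r)"
    using q_pos[of k] by (simp add: scaleR_add_right)
  then show ?thesis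
    using bound q_pos[of k] by (simp add: divide_le_eq)
qed

text \<open>Strong induction on \<open>p\<close>. Among the terms subtracted in \<open>u k\<close>,
  those with \<open>i < n\<close> have coefficient 0 and the others lie in the closed span by
  induction. So \<open>u k\<close> lies there too, and it approaches \<open>\<phi> p\<close> along
  \<open>A\<close>.\<close>

lemma \<phi>_mem_closed_span:
  assumes "infinite A" "A \<subseteq> b -` {n}" "n \<le> p"
  shows "\<phi> p \<in> closed_span (x ` A)"
  using assms(3)
proof (induction p rule: less_induct)
  case (less p)
  define u where "u k = (1 / q k ^ p) *\<^sub>R (x k - (\<Sum>i<p. coef k i *\<^sub>R \<phi> i))" for k
  have u: "u k \<in> closed_span (x ` A)" if "k \<in> A" for k
  proof -
    have "coef k i *\<^sub>R \<phi> i \<in> closed_span (x ` A)" if "i < p" for i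
    proof (cases "n \<le> i")
      case True
      then show ?thesis
        using less.IH that by (intro scaleR_mem_subspace subspace_closed_span) auto
    next
      case False
      then show ?thesis
        using \<open>k \<in> A\<close> assms(2) subspace_0[OF subspace_closed_span] by (auto simp: coef_def)
    qed
    then have "(\<Sum>i<p. coef k i *\<^sub>R \<phi> i) \<in> closed_span (x ` A)"
      by (intro subspace_sum subspace_closed_span) auto
    moreover have "x k \<in> closed_span (x ` A)" using that closed_span_superset by blast
    ultimately show ?thesis
      unfolding u_def by (intro scaleR_mem_subspace subspace_diff subspace_closed_span)
  qed
  have "\<exists>y\<in>closed_span (x ` A). dist y (\<phi> p) < \<epsilon>" if "\<epsilon> > 0" for \<epsilon>
  proof -
    obtain N where N: "(1/2::real) ^ N < \<epsilon> / 3"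
      using real_arch_pow_inv[of "\<epsilon> / 3" "1/2"] \<open>\<epsilon> > 0\<close> by auto
    \<comment> \<open>\<open>N < k\<close> makes the error \<open>3 * q k\<close> smaller than
      \<epsilon>, and \<open>p < k\<close> is what \<open>\<phi>_approx\<close> requires.\<close>
    obtain k where k: "k \<in> A" "max N p < k"
      using assms(1) by (meson infinite_nat_iff_unbounded)
    have "q k \<le> (1/2) ^ N" unfolding q_def using k by (intro power_decreasing) auto
    moreover have "norm (u k - \<phi> p) \<le> 3 * q k"
      unfolding u_def using k less.prems assms(2) by (intro \<phi>_approx) auto
    ultimately have "dist (u k) (\<phi> p) < \<epsilon>" using N by (simp add: dist_norm)
    then show ?thesis using u k by blast
  qed
  then have "\<phi> p \<in> closure (closed_span (x ` A))" by (simp add: closure_approachable)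
  then show ?case by (simp add: closed_closed_span closure_closed)
qed

text \<open>Indices with \<open>b k = 0\<close> give every \<open>\<phi> p\<close>; subtracting the
  series from \<open>x k\<close> then leaves a nonzero multiple of \<open>e k\<close>.\<close>

lemma complete_x:
  assumes "infinite (b -` {0})"
  shows "complete_system x"
proof -
  have \<phi>: "\<phi> p \<in> closed_span (range x)" for p
    using \<phi>_mem_closed_span[of "b -` {0}" 0 p] closed_span_mono[of "x ` (b -` {0})" "range x"] assms
    by auto
  have "e k \<in> closed_span (range x)" for k
  proof -
    have "(\<Sum>i. coef k i *\<^sub>R \<phi> i) \<in> closed_span (range x)"
      by (rule closed_sequentially[OF closed_closed_span _ summable_LIMSEQ[OF summable_coef_\<phi>]])
         (intro allI subspace_sum scaleR_mem_subspace subspace_closed_span \<phi>)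
    moreover have "x k \<in> closed_span (range x)" using closed_span_superset by blast
    ultimately have "x k - (\<Sum>i. coef k i *\<^sub>R \<phi> i) \<in> closed_span (range x)"
      by (intro subspace_diff subspace_closed_span)
    then have "q k ^ k *\<^sub>R e k \<in> closed_span (range x)" by (simp add: x_def)
    then show ?thesis
      using scaleR_mem_subspace[OF subspace_closed_span, of _ _ "1 / q k ^ k"] q_pos[of k]
      by fastforce
  qed
  then have "closed_span (range \<phi> \<union> range e) \<subseteq> closed_span (range x)"
    using \<phi> by (intro closed_span_minimal subspace_closed_span closed_closed_span) auto
  then show ?thesis using dense by (auto simp: complete_system_def)
qed

section \<open>Computation of the defects\<close>

text \<open>The dimension comes from \<open>edim_eq\<close>: vectors \<open>w i\<close> in the
  orthogonal complement \<open>Z\<close>, dual to the \<open>\<phi> i\<close> with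
  \<open>i \<in> J\<close>, which span \<open>Z\<close> when \<open>J\<close> is finite.\<close>

lemma defect_x:
  fixes \<sigma> :: "nat set"
  defines "J \<equiv> {i \<in> I. \<forall>n. infinite (\<sigma> \<inter> b -` {n}) \<longrightarrow> i < n}"
  shows "defect x x' \<sigma> = (if finite J then enat (card J) else \<infinity>)"
proof -
  define Z where "Z = orth_compl (x ` \<sigma> \<union> x' ` (- \<sigma>))"
  have Z_iff: "z \<in> Z \<longleftrightarrow> (\<forall>k\<in>\<sigma>. ip z (x k) = 0) \<and> (\<forall>k\<in>-\<sigma>. ip z (e k) = 0)" for z
    using q_pos by (simp add: Z_def orth_compl_def x'_def ball_Un less_imp_neq[symmetric])
  have Z: "subspace Z" by (simp add: Z_def subspace_orth_compl)
  \<comment> \<open>The indices in \<sigma> whose series may involve \<open>\<phi> i\<close>. For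
    \<open>i \<in> J\<close> each of the finitely many fibres of \<open>b\<close> over
    \<open>n \<le> i\<close> meets \<sigma> in a finite set.\<close>
  define K where "K i = {k \<in> \<sigma>. b k \<le> i}" for i
  have finite_K: "finite (K i)" if "i \<in> J" for i
  proof -
    have "K i = (\<Union>n\<in>{..i}. \<sigma> \<inter> b -` {n})" by (auto simp: K_def)
    also have "finite \<dots>"
    proof (rule finite_UN_I)
      show "finite (\<sigma> \<inter> b -` {n})" if "n \<in> {..i}" for n
        using \<open>i \<in> J\<close> that by (auto simp: J_def)
    qed simp
    finally show ?thesis .
  qed
  \<comment> \<open>The coefficients solve \<open>ip (w i) (x k) = 0\<close> for
    \<open>k \<in> K i\<close>: there \<open>\<phi> i\<close> contributes \<open>q k ^ i\<close>,
    while \<open>x k\<close> has \<open>e k\<close>-component \<open>q k ^ k\<close>. As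
    \<open>K i \<subseteq> \<sigma>\<close>, orthogonality to \<open>e k\<close> for
    \<open>k\<close> outside \<sigma> is kept.\<close>
  define w where "w i = \<phi> i - (\<Sum>k\<in>K i. (q k ^ i / q k ^ k) *\<^sub>R e k)" for i
  have w_e: "ip (w i) (e j) = (if j \<in> K i then - of_real (q j ^ i / q j ^ j) else 0)"
    if "i \<in> J" for i j
  proof -
    have "ip (w i) (e j) = - (\<Sum>k\<in>K i. if k = j then of_real (q j ^ i / q j ^ j) else 0)"
      unfolding w_def ip_diff_left ip_sum_left ip_\<phi>_e
      by (simp, rule sum.cong) (auto simp: ip_e)
    then show ?thesis using finite_K[OF that] by simp
  qed
  have w_\<phi>: "ip (w i) (\<phi> j) = ip (\<phi> i) (\<phi> j)" for i j
    by (simp add: w_def ip_diff_left ip_sum_left ip_e_\<phi>)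
  have w_series: "ip (w i) (\<Sum>j. coef k j *\<^sub>R \<phi> j) = of_real (coef k i)" if "i \<in> J" for i k
  proof -
    \<comment> \<open>The correction \<open>w i - \<phi> i\<close> is a combination of the
      \<open>e k\<close>, which the series does not see.\<close>
    have "ip (w i - \<phi> i) (\<Sum>j. coef k j *\<^sub>R \<phi> j) = 0"
      by (rule series_orth) (simp add: ip_diff_left w_\<phi>)
    then show ?thesis using that by (simp add: ip_diff_left ip_\<phi>_series J_def)
  qed
  have w_Z: "w i \<in> Z" if "i \<in> J" for i
    using that w_e[OF that] w_series[OF that] q_pos
    by (auto simp: Z_iff x_def ip_add_right K_def coef_def less_imp_neq[symmetric])
  have Z_\<phi>: "ip z (\<phi> i) = 0" if "z \<in> Z" "i \<notin> J" for z i
  proof (cases "i \<in> I")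
    case True
    then obtain n where n: "infinite (\<sigma> \<inter> b -` {n})" "n \<le> i"
      using \<open>i \<notin> J\<close> by (auto simp: J_def not_less)
    then have "\<phi> i \<in> closed_span (x ` (\<sigma> \<inter> b -` {n}))"
      by (intro \<phi>_mem_closed_span) auto
    then show ?thesis
      by (rule closed_span_orth[rotated]) (use \<open>z \<in> Z\<close> in \<open>auto simp: Z_iff\<close>)
  next
    case False
    then have "\<phi> i = 0" using ip_\<phi>[of i i] by (simp add: ip_self_eq_0_iff)
    then show ?thesis using ip_eq_0_commute[of z 0] by simp
  qed
  \<comment> \<open>An element of \<open>Z\<close> orthogonal to every \<open>\<phi> i\<close> is
    orthogonal to the series in \<open>x k\<close>, so for \<open>k \<in> \<sigma>\<close>
    orthogonality to \<open>x k\<close> becomes orthogonality to \<open>e k\<close>.\<close>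
  have Z_zero: "z = 0" if "z \<in> Z" "\<And>i. i \<in> J \<Longrightarrow> ip z (\<phi> i) = 0" for z
  proof (rule zero_if_orth_dense[OF dense])
    have \<phi>: "ip z (\<phi> i) = 0" for i using that Z_\<phi> by blast
    have "ip z (e k) = 0" for k
      using \<open>z \<in> Z\<close> series_orth[OF \<phi>, of k] q_pos[of k]
      by (cases "k \<in> \<sigma>") (auto simp: Z_iff x_def ip_add_right)
    then show "ip z a = 0" if "a \<in> range \<phi> \<union> range e" for a
      using \<phi> that by auto
  qed
  have "Z \<subseteq> span (w ` J)" if "finite J"
  proof
    fix z assume z: "z \<in> Z"
    \<comment> \<open>By duality \<open>y\<close> has the same products as \<open>z\<close> with all
      \<open>\<phi> j\<close>, \<open>j \<in> J\<close>, so \<open>Z_zero\<close> identifies the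
      two.\<close>
    define y where "y = (\<Sum>i\<in>J. scale (ip z (\<phi> i)) (w i))"
    have "ip (z - y) (\<phi> j) = 0" if "j \<in> J" for j
    proof -
      have "ip y (\<phi> j) = (\<Sum>i\<in>J. if i = j then ip z (\<phi> j) else 0)"
        unfolding y_def ip_sum_left ip_scale_left w_\<phi> using that
        by (intro sum.cong) (auto simp: ip_\<phi> J_def)
      then show ?thesis using \<open>finite J\<close> that by (simp add: ip_diff_left)
    qed
    moreover have "z - y \<in> Z"
      unfolding y_def by (intro subspace_diff subspace_sum subspace_scale Z z w_Z)
    ultimately have "z = y" using Z_zero[of "z - y"] by simp
    also have "y \<in> span (w ` J)"
      unfolding y_def by (intro span_sum span_scale span_base) auto
    finally show "z \<in> span (w ` J)" .
  qed
  then have "edim Z = (if finite J then enat (card J) else \<infinity>)"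
    using Z w_Z by (intro edim_eq[where w = w and f = \<phi>]) (auto simp: w_\<phi> ip_\<phi> J_def)
  then show ?thesis
    by (simp add: defect_def Z_def orth_compl_closed_span)
qed

end

section \<open>Realising a prescribed set of defects\<close>

theorem theorem19:
  fixes scale :: "'k::real_or_complex \<Rightarrow> 'a::banach \<Rightarrow> 'a"
    and ip :: "'a \<Rightarrow> 'a \<Rightarrow> 'k"
    and S :: "enat set"
  assumes "hilbert_space scale ip"
    and "separable_space (euclidean :: 'a topology)"
    and "hilbert_space.edim scale (UNIV :: 'a set) = \<infinity>"
    and "0 \<in> S"
    and "(finite S \<and> S \<subseteq> range enat) \<or> \<infinity> \<in> S"
  shows "\<exists>x x'. hilbert_space.complete_system scale x \<and>
                hilbert_space.minimal_system scale x \<and>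
                hilbert_space.biorthogonal ip x x' \<and>
                {hilbert_space.defect scale ip x x' \<sigma> | \<sigma>. \<sigma> \<subseteq> (UNIV :: nat set)} = S"
proof -
  interpret hilbert_space scale ip by fact
  obtain G where G: "countable G" "infinite G" "closed_span G = UNIV"
    and orth: "\<And>g h. g \<in> G \<Longrightarrow> h \<in> G \<Longrightarrow> ip g h = (if g = h then 1 else 0)"
    using orthonormal_basis_exists assms(2,3) by blast
  \<comment> \<open>Strictness makes \<open>I\<close> have exactly as many elements as the supremum
    of \<open>S\<close>: \<open>{..<N}\<close> for a maximum \<open>N\<close>, everything if
    \<open>\<infinity> \<in> S\<close>.\<close>
  define I where "I = {i. \<exists>s\<in>S. enat i < s}"
  \<comment> \<open>A tagged index set for \<open>G\<close>. The \<open>Inr\<close> copy keeps it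
    infinite even when \<open>I\<close> is finite or empty.\<close>
  define M :: "(nat + nat) set" where "M = Inl ` I \<union> range Inr"
  have M: "countable M" "infinite M"
    by (auto simp: M_def finite_image_iff)
  obtain \<beta> where \<beta>: "bij_betw \<beta> M G"
    using bij_betw_trans[OF to_nat_on_infinite[OF M] bij_betw_from_nat_into[OF G(1,2)]] by blast
  define \<phi> where "\<phi> i = (if i \<in> I then \<beta> (Inl i) else 0)" for i
  define e where "e k = \<beta> (Inr k)" for k
  \<comment> \<open>The first coordinate of the pairing takes every value infinitely often. Values
    outside \<open>S\<close> are replaced by 0, which lies in \<open>S\<close>.\<close>
  define b where "b k = (let n = fst (prod_decode k) in if enat n \<in> S then n else 0)" for k
  have ip_\<beta>: "ip (\<beta> s) (\<beta> t) = (if s = t then 1 else 0)" if "s \<in> M" "t \<in> M" for s t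
    using orth[of "\<beta> s" "\<beta> t"] that \<beta> by (auto simp: bij_betw_def inj_on_def)
  interpret perturbed_basis scale ip \<phi> e I b
  proof
    have "G \<subseteq> range \<phi> \<union> range e"
    proof
      fix g assume "g \<in> G"
      then obtain s where s: "s \<in> M" "g = \<beta> s" using \<beta> by (auto simp: bij_betw_def)
      then consider i where "i \<in> I" "s = Inl i" | k where "s = Inr k" by (auto simp: M_def)
      then show "g \<in> range \<phi> \<union> range e"
        by cases (use s in \<open>auto simp: \<phi>_def e_def intro!: rev_image_eqI\<close>)
    qed
    then show "closed_span (range \<phi> \<union> range e) = UNIV"
      using closed_span_mono G(3) by blast
  next
    show "ip (\<phi> i) (\<phi> j) = (if i = j \<and> i \<in> I then 1 else 0)" for i j
      using ip_\<beta>[of "Inl i" "Inl j"] ip_eq_0_commute[of _ 0] by (auto simp: \<phi>_def M_def)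
    show "ip (e k) (e l) = (if k = l then 1 else 0)" for k l
      using ip_\<beta>[of "Inr k" "Inr l"] by (auto simp: e_def M_def)
    show "ip (\<phi> i) (e k) = 0" for i k
      using ip_\<beta>[of "Inl i" "Inr k"] by (auto simp: e_def \<phi>_def M_def)
  qed
  have b_S: "enat (b k) \<in> S" for k
    using assms(4) by (simp add: b_def Let_def zero_enat_def)
  have b_infinite: "infinite (b -` {n})" if "enat n \<in> S" for n
  proof
    assume "finite (b -` {n})"
    moreover have "range (\<lambda>l. prod_encode (n, l)) \<subseteq> b -` {n}" using that by (auto simp: b_def)
    ultimately have "finite (range (\<lambda>l. prod_encode (n, l)))" using finite_subset by blast
    then show False by (simp add: finite_image_iff inj_on_def)
  qed
  have I_less: "i \<in> I" if "i < n" "enat n \<in> S" for i n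
    using that by (force simp: I_def)
  define J where "J \<sigma> = {i \<in> I. \<forall>n. infinite (\<sigma> \<inter> b -` {n}) \<longrightarrow> i < n}" for \<sigma>
  have defect: "defect x x' \<sigma> = (if finite (J \<sigma>) then enat (card (J \<sigma>)) else \<infinity>)" for \<sigma>
    unfolding J_def by (rule defect_x)
  have I_UNIV: "I = UNIV" if "\<infinity> \<in> S" using that by (force simp: I_def)
  have "defect x x' \<sigma> \<in> S" for \<sigma>
  proof (cases "\<exists>n. infinite (\<sigma> \<inter> b -` {n})")
    case True
    \<comment> \<open>The least such \<open>n\<close> imposes the strongest bound in
      \<open>J \<sigma>\<close>. It is a value of \<open>b\<close>, hence in \<open>S\<close>, so
      all smaller integers belong to \<open>I\<close>.\<close>
    define n where "n = (LEAST n. infinite (\<sigma> \<inter> b -` {n}))"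
    have n: "infinite (\<sigma> \<inter> b -` {n})" "\<And>m. infinite (\<sigma> \<inter> b -` {m}) \<Longrightarrow> n \<le> m"
      unfolding n_def using LeastI_ex[OF True] by (auto intro: Least_le)
    then obtain k where "k \<in> \<sigma> \<inter> b -` {n}" by (metis finite.emptyI ex_in_conv)
    then have "enat n \<in> S" using b_S[of k] by auto
    moreover have "J \<sigma> = {..<n}"
      using n I_less \<open>enat n \<in> S\<close> by (force simp: J_def)
    ultimately show ?thesis by (simp add: defect)
  next
    case False
    \<comment> \<open>No fibre meets \<sigma> infinitely often, so no bound remains and the defect
      is the size of \<open>I\<close>, that is, the supremum of \<open>S\<close>.\<close>
    then have J: "J \<sigma> = I" by (auto simp: J_def)
    show ?thesis
    proof (cases "\<infinity> \<in> S")
      case True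
      then show ?thesis by (simp add: defect J I_UNIV)
    next
      case False
      then have S: "finite S" "S \<subseteq> range enat" using assms(5) by auto
      then have "Max S \<in> S" using assms(4) by (intro Max_in) auto
      then obtain N where N: "Max S = enat N" using S by auto
      have "I = {..<N}"
      proof (intro equalityI subsetI)
        fix i assume "i \<in> I"
        then obtain s where "s \<in> S" "enat i < s" by (auto simp: I_def)
        then have "enat i < enat N" using Max_ge[OF S(1), of s] N by (metis less_le_trans)
        then show "i \<in> {..<N}" by simp
      qed (use I_less N \<open>Max S \<in> S\<close> in auto)
      then show ?thesis using N \<open>Max S \<in> S\<close> by (simp add: defect J)
    qed
  qed
  moreover have "\<exists>\<sigma>. s = defect x x' \<sigma>" if "s \<in> S" for s
  proof (cases s)
    case (enat n)
    \<comment> \<open>A whole fibre serves as \<sigma>: distinct fibres are disjoint, so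
      \<open>n\<close> is the only bound.\<close>
    have fib: "infinite (b -` {n} \<inter> b -` {m}) \<longleftrightarrow> m = n" for m
    proof (cases "m = n")
      case False
      then have "b -` {n} \<inter> b -` {m} = {}" by auto
      then show ?thesis using False by simp
    qed (use b_infinite that enat in simp)
    have "J (b -` {n}) = {..<n}"
      using I_less that enat unfolding J_def fib by auto
    then show ?thesis using enat by (intro exI[of _ "b -` {n}"]) (simp add: defect)
  next
    case infinity
    \<comment> \<open>The empty \<sigma> imposes no bound, which leaves the infinite set
      \<open>I\<close>.\<close>
    then have "J {} = UNIV" using I_UNIV that by (simp add: J_def)
    then show ?thesis using infinity by (intro exI[of _ "{}"]) (simp add: defect)
  qed
  ultimately have "{defect x x' \<sigma> | \<sigma>. \<sigma> \<subseteq> (UNIV :: nat set)} = S" by auto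
  moreover have "complete_system x"
    using complete_x b_infinite[of 0] assms(4) by (simp add: zero_enat_def)
  ultimately show ?thesis
    using biorthogonal_x minimal_if_biorthogonal by blast
qed

end
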